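(* Let $F$ be a differential field of characteristic zero with algebraically closed field of constants, and let $n\ge1$. Let $R=F\{Y_{ij}\}[X_{ij}]$ ($1\le i,j\le n$) with the derivation $D$ extending that of $F\{Y_{ij}\}$ and satisfying $D(X_{ij})=\sum_{\ell=1}^n Y_{i\ell}X_{\ell j}$. Let $p\in F[X_{ij}]$, $p\neq0$, and $q\in F\{Y_{ij}\}$ satisfy $D(p)=qp$. Then there are $a\in\mathbb{N}$ and $\ell\in F$ such that $$p=\ell\,\det[X_{ij}]^a\qquad\text{and}\qquad q=\frac{\ell'}{\ell}+a\sum_{i=1}^n Y_{ii}.$$
   Context: $F\{Y_{ij}\}$ is the ring of differential polynomials over $F$ in the differential indeterminates $Y_{ij}$, $1\le i,j\le n$, and the $X_{ij}$, $1\le i,j\le n$, are algebraically independent over its quotient field. $\ell'$ denotes the derivative of $\ell$ in $F$. $\mathbb{N}$ includes $0$. *)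

theory Defs
  imports
    "HOL-Library.Poly_Mapping"
    "HOL-Computational_Algebra.Polynomial"
    "HOL-Analysis.Determinants"
begin

definition derivation :: "('a::comm_ring_1 \<Rightarrow> 'a) \<Rightarrow> bool" where
  "derivation d \<longleftrightarrow>
     (\<forall>x y. d (x + y) = d x + d y) \<and> (\<forall>x y. d (x * y) = d x * y + x * d y)"

definition constants :: "('a::comm_ring_1 \<Rightarrow> 'a) \<Rightarrow> 'a set" where
  "constants d = {c. d c = 0}"

text \<open>The subfield of constants is a set, not a type, so the class \<open>alg_closed_field\<close> does not
  apply to it.\<close>

definition alg_closed_subfield :: "'a::field set \<Rightarrow> bool" where
  "alg_closed_subfield C \<longleftrightarrow>
     (\<forall>f :: 'a poly. (\<forall>i. coeff f i \<in> C) \<longrightarrow> degree f > 0 \<longrightarrow> (\<exists>c\<in>C. poly f c = 0))"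

type_synonym ('v, 'a) mpol = "('v \<Rightarrow>\<^sub>0 nat) \<Rightarrow>\<^sub>0 'a"

definition Const :: "'a::comm_ring_1 \<Rightarrow> ('v, 'a) mpol" where
  "Const c = Poly_Mapping.single 0 c"

definition Var :: "'v \<Rightarrow> ('v, 'a::comm_ring_1) mpol" where
  "Var v = Poly_Mapping.single (Poly_Mapping.single v 1) 1"

text \<open>\<open>ext_deriv d g\<close> is the derivation of the polynomial ring that acts as \<open>d\<close> on the coefficient
  ring and sends each variable \<open>v\<close> to \<open>g v\<close>: it maps a term \<open>c m\<close>, with \<open>m\<close> a monomial, to
  \<open>d(c) m\<close> plus the sum over the variables \<open>v\<close> of \<open>m\<close> of \<open>c (\<partial>m/\<partial>v) g(v)\<close>.
  Existence and uniqueness are the lemmas \<open>derivation_ext_deriv\<close>, \<open>ext_deriv_Const\<close>,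
  \<open>ext_deriv_Var\<close> and \<open>ext_deriv_unique\<close>.\<close>

definition ext_deriv ::
  "('a::comm_ring_1 \<Rightarrow> 'a) \<Rightarrow> ('v \<Rightarrow> ('v, 'a) mpol) \<Rightarrow> ('v, 'a) mpol \<Rightarrow> ('v, 'a) mpol" where
  "ext_deriv d g p =
     (\<Sum>m\<in>Poly_Mapping.keys p.
        Poly_Mapping.single m (d (Poly_Mapping.lookup p m)) +
        (\<Sum>v\<in>Poly_Mapping.keys m.
           Poly_Mapping.single (m - Poly_Mapping.single v 1)
             (of_nat (Poly_Mapping.lookup m v) * Poly_Mapping.lookup p m) * g v))"

lemma derivation_0: "derivation d \<Longrightarrow> d 0 = 0"
  unfolding derivation_def by (metis add_cancel_left_left)

lemma derivation_1: "derivation d \<Longrightarrow> d 1 = 0"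
  unfolding derivation_def by (metis add_cancel_left_left mult.left_neutral mult.right_neutral)

lemma Const_0 [simp]: "Const 0 = 0"
  and Const_1 [simp]: "Const 1 = 1"
  and Const_add: "Const (a + b) = Const a + Const b"
  and Const_mult: "Const (a * b) = Const a * Const b"
  by (simp_all add: Const_def single_add mult_single)

lemma single_sum:
  fixes p :: "'b \<Rightarrow>\<^sub>0 'c::comm_monoid_add"
  shows "(\<Sum>m\<in>Poly_Mapping.keys p. Poly_Mapping.single m (Poly_Mapping.lookup p m)) = p"
  by (rule poly_mapping_eqI)
     (simp add: lookup_sum lookup_single when_def in_keys_iff)

lemma mpol_sum_induct:
  fixes p :: "'b \<Rightarrow>\<^sub>0 'c::comm_monoid_add"
  assumes "P 0" "\<And>p q. P p \<Longrightarrow> P q \<Longrightarrow> P (p + q)"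
    and "\<And>m c. P (Poly_Mapping.single m c)"
  shows "P p"
proof -
  have "P (\<Sum>m\<in>A. Poly_Mapping.single m (Poly_Mapping.lookup p m))" for A
    by (induction A rule: infinite_finite_induct) (auto intro: assms)
  from this[of "Poly_Mapping.keys p"] show ?thesis by (simp add: single_sum)
qed

lemma mpol_induct [case_names Const Var add mult]:
  fixes p :: "('v, 'a::comm_ring_1) mpol"
  assumes C: "\<And>c. P (Const c)" and V: "\<And>v. P (Var v)"
    and A: "\<And>p q. P p \<Longrightarrow> P q \<Longrightarrow> P (p + q)" and M: "\<And>p q. P p \<Longrightarrow> P q \<Longrightarrow> P (p * q)"
  shows "P p"
proof (rule mpol_sum_induct)
  show "P 0" using C[of 0] by simp
  fix m and c :: 'a
  have "P (Poly_Mapping.single m 1)"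
  proof -
    have one: "P 1" using C[of 1] by simp
    have *: "P (Poly_Mapping.single (Poly_Mapping.single v k) 1)" for v k
    proof (induction k)
      case (Suc k)
      have "Poly_Mapping.single (Poly_Mapping.single v (Suc k)) (1::'a) =
            Var v * Poly_Mapping.single (Poly_Mapping.single v k) 1"
        by (simp add: Var_def mult_single flip: single_add)
      with M[OF V Suc] show ?case by simp
    qed (use one in simp)
    have "P (Poly_Mapping.single (\<Sum>v\<in>A. Poly_Mapping.single v (Poly_Mapping.lookup m v)) 1)" for A
    proof (induction A rule: infinite_finite_induct)
      case (insert x F)
      from M[OF *[of x "Poly_Mapping.lookup m x"] insert.IH] insert.hyps
      show ?case by (simp add: mult_single)
    qed (use one in simp_all)
    from this[of "Poly_Mapping.keys m"] show ?thesis by (simp add: single_sum)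
  qed
  from M[OF C[of c] this] show "P (Poly_Mapping.single m c)"
    by (simp add: Const_def mult_single)
qed (rule A)

lemma ext_deriv_superset:
  assumes "derivation d" "finite S" "Poly_Mapping.keys p \<subseteq> S"
  shows "ext_deriv d g p =
     (\<Sum>m\<in>S. Poly_Mapping.single m (d (Poly_Mapping.lookup p m)) +
        (\<Sum>v\<in>Poly_Mapping.keys m.
           Poly_Mapping.single (m - Poly_Mapping.single v 1)
             (of_nat (Poly_Mapping.lookup m v) * Poly_Mapping.lookup p m) * g v))"
  unfolding ext_deriv_def
  by (rule sum.mono_neutral_left)
     (use assms in \<open>auto simp: in_keys_iff derivation_0\<close>)

lemma ext_deriv_add:
  assumes d: "derivation d"
  shows "ext_deriv d g (p + q) = ext_deriv d g p + ext_deriv d g q"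
proof -
  let ?S = "Poly_Mapping.keys p \<union> Poly_Mapping.keys q"
  have "Poly_Mapping.keys (p + q) \<subseteq> ?S" by (rule Poly_Mapping.keys_add)
  moreover have "d (x + y) = d x + d y" for x y using d by (simp add: derivation_def)
  ultimately show ?thesis
    using d
    by (simp add: ext_deriv_superset[where S = ?S] lookup_add single_add
        sum.distrib[symmetric] algebra_simps)
qed

lemma ext_deriv_single:
  assumes d: "derivation d" and S: "finite S" "Poly_Mapping.keys m \<subseteq> S"
  shows "ext_deriv d g (Poly_Mapping.single m c) =
     Poly_Mapping.single m (d c) +
        (\<Sum>v\<in>S. Poly_Mapping.single (m - Poly_Mapping.single v 1)
             (of_nat (Poly_Mapping.lookup m v) * c) * g v)"
proof -
  have "(\<Sum>v\<in>S. Poly_Mapping.single (m - Poly_Mapping.single v 1)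
             (of_nat (Poly_Mapping.lookup m v) * c) * g v) =
        (\<Sum>v\<in>Poly_Mapping.keys m. Poly_Mapping.single (m - Poly_Mapping.single v 1)
             (of_nat (Poly_Mapping.lookup m v) * c) * g v)"
    by (rule sum.mono_neutral_right) (use S in \<open>auto simp: in_keys_iff\<close>)
  moreover have "ext_deriv d g (Poly_Mapping.single m c) =
     (\<Sum>m'\<in>{m}. Poly_Mapping.single m' (d (Poly_Mapping.lookup (Poly_Mapping.single m c) m')) +
        (\<Sum>v\<in>Poly_Mapping.keys m'.
           Poly_Mapping.single (m' - Poly_Mapping.single v 1)
             (of_nat (Poly_Mapping.lookup m' v) *
              Poly_Mapping.lookup (Poly_Mapping.single m c) m') * g v))"
    by (rule ext_deriv_superset) (use d in auto)
  ultimately show ?thesis by simp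
qed

lemma single_shift_mult:
  fixes c c' :: "'a::comm_ring_1"
  shows "Poly_Mapping.single m c *
     Poly_Mapping.single (m' - Poly_Mapping.single v 1) (of_nat (Poly_Mapping.lookup m' v) * c') =
   Poly_Mapping.single (m + m' - Poly_Mapping.single v 1)
     (of_nat (Poly_Mapping.lookup m' v) * (c * c'))"
proof (cases "Poly_Mapping.lookup m' v = 0")
  case False
  then have "m + (m' - Poly_Mapping.single v 1) = m + m' - Poly_Mapping.single v 1"
    by (intro poly_mapping_eqI)
       (auto simp: lookup_add lookup_minus lookup_single when_def)
  then show ?thesis by (simp add: mult_single mult.left_commute)
qed simp

lemma ext_deriv_mult_single:
  assumes d: "derivation d"
  shows "ext_deriv d g (Poly_Mapping.single m c * Poly_Mapping.single m' c') =
     ext_deriv d g (Poly_Mapping.single m c) * Poly_Mapping.single m' c' +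
     Poly_Mapping.single m c * ext_deriv d g (Poly_Mapping.single m' c')"
proof -
  let ?S = "Poly_Mapping.keys m \<union> Poly_Mapping.keys m'"
  let ?s = "\<lambda>m c v. Poly_Mapping.single (m - Poly_Mapping.single v 1)
               (of_nat (Poly_Mapping.lookup m v) * c)"
  have dm: "d (c * c') = d c * c' + c * d c'" using d by (simp add: derivation_def)
  have split: "?s (m + m') (c * c') v = ?s m c v * Poly_Mapping.single m' c' +
        Poly_Mapping.single m c * ?s m' c' v" for v
    unfolding mult.commute[of "?s m c v"] single_shift_mult
    by (simp add: lookup_add single_add algebra_simps flip: single_add)
  have "ext_deriv d g (Poly_Mapping.single m c * Poly_Mapping.single m' c') =
     Poly_Mapping.single (m + m') (d (c * c')) + (\<Sum>v\<in>?S. ?s (m + m') (c * c') v * g v)"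
    unfolding mult_single
    by (rule ext_deriv_single[OF d]) (use Poly_Mapping.keys_add[of m m'] in auto)
  also have "\<dots> = (Poly_Mapping.single m (d c) + (\<Sum>v\<in>?S. ?s m c v * g v)) *
         Poly_Mapping.single m' c' +
       Poly_Mapping.single m c *
         (Poly_Mapping.single m' (d c') + (\<Sum>v\<in>?S. ?s m' c' v * g v))"
  proof -
    have "(\<Sum>v\<in>S. (A v * c + b * B v) * g v) = (\<Sum>v\<in>S. A v * g v) * c + b * (\<Sum>v\<in>S. B v * g v)"
      for A B g :: "'c \<Rightarrow> 'd::comm_ring_1" and S b c
      by (simp add: sum_distrib_left sum_distrib_right sum.distrib[symmetric] algebra_simps)
    note * = this
    show ?thesis
      unfolding split dm *
      by (simp only: distrib_left distrib_right mult_single single_add add_ac)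
  qed
  also have "Poly_Mapping.single m (d c) + (\<Sum>v\<in>?S. ?s m c v * g v) =
      ext_deriv d g (Poly_Mapping.single m c)"
    by (rule ext_deriv_single[OF d, symmetric]) auto
  also have "Poly_Mapping.single m' (d c') + (\<Sum>v\<in>?S. ?s m' c' v * g v) =
      ext_deriv d g (Poly_Mapping.single m' c')"
    by (rule ext_deriv_single[OF d, symmetric]) auto
  finally show ?thesis .
qed

lemma derivation_ext_deriv:
  assumes d: "derivation d"
  shows "derivation (ext_deriv d g)"
proof -
  have 0: "ext_deriv d g 0 = 0" by (simp add: ext_deriv_def)
  have 1: "ext_deriv d g (Poly_Mapping.single m c * q) =
     ext_deriv d g (Poly_Mapping.single m c) * q + Poly_Mapping.single m c * ext_deriv d g q"
    for m c q
    by (induction q rule: mpol_sum_induct)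
       (simp_all add: 0 ext_deriv_mult_single[OF d] ext_deriv_add[OF d] ring_distribs add_ac)
  have "ext_deriv d g (p * q) = ext_deriv d g p * q + p * ext_deriv d g q" for p q
    by (induction p rule: mpol_sum_induct)
       (simp_all add: 0 1 ext_deriv_add[OF d] ring_distribs add_ac)
  then show ?thesis by (simp add: derivation_def ext_deriv_add[OF d])
qed

lemma ext_deriv_Const:
  assumes "derivation d"
  shows "ext_deriv d g (Const c) = Const (d c)"
  using ext_deriv_single[OF assms, of "{}" 0] by (simp add: Const_def)

lemma ext_deriv_Var:
  assumes "derivation d"
  shows "ext_deriv d g (Var v) = g v"
  using ext_deriv_single[OF assms, of "{v}" "Poly_Mapping.single v 1" g 1]
  by (simp add: Var_def derivation_1[OF assms])

lemma ext_deriv_unique: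
  assumes d: "derivation d" and D: "derivation D"
    and "\<And>c. D (Const c) = Const (d c)" "\<And>v. D (Var v) = g v"
  shows "D = ext_deriv d g"
proof
  fix p show "D p = ext_deriv d g p"
    by (induction p rule: mpol_induct)
       (use D derivation_ext_deriv[OF d, of g] in
         \<open>auto simp: assms ext_deriv_Const[OF d] ext_deriv_Var[OF d] derivation_def\<close>)
qed

text \<open>\<open>dpol\<close> is $F\{Y_{ij}\}$ and \<open>dpol_X\<close> is $R = F\{Y_{ij}\}[X_{ij}]$. The
  variable \<open>(i, j, k)\<close> of a differential polynomial is the \<open>k\<close>-th derivative of $Y_{ij}$. The
  indices range over an arbitrary finite type, so $n$ is its cardinality.\<close>

type_synonym ('n, 'a) dpol = "('n \<times> 'n \<times> nat, 'a) mpol"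

type_synonym ('n, 'a) dpol_X = "('n \<times> 'n, ('n, 'a) dpol) mpol"

definition Y_var :: "'n \<Rightarrow> 'n \<Rightarrow> ('n, 'a::comm_ring_1) dpol" where
  "Y_var i j = Var (i, j, 0)"

definition dpol_deriv :: "('a::comm_ring_1 \<Rightarrow> 'a) \<Rightarrow> ('n, 'a) dpol \<Rightarrow> ('n, 'a) dpol" where
  "dpol_deriv d = ext_deriv d (\<lambda>(i, j, k). Var (i, j, Suc k))"

definition X_var :: "'n \<Rightarrow> 'n \<Rightarrow> ('n, 'a::comm_ring_1) dpol_X" where
  "X_var i j = Var (i, j)"

definition R_deriv :: "('a::comm_ring_1 \<Rightarrow> 'a) \<Rightarrow> ('n::finite, 'a) dpol_X \<Rightarrow> ('n, 'a) dpol_X" where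
  "R_deriv d = ext_deriv (dpol_deriv d) (\<lambda>(i, j). \<Sum>l\<in>UNIV. Const (Y_var i l) * X_var l j)"

definition X_matrix :: "('n::finite, 'a::comm_ring_1) dpol_X ^ 'n ^ 'n" where
  "X_matrix = (\<chi> i j. X_var i j)"

text \<open>The subring of polynomials in the $X_{ij}$ whose coefficients lie in \<open>F\<close>, embedded in the
  differential polynomials by \<open>Const\<close>.\<close>

definition F_X :: "('n, 'a::comm_ring_1) dpol_X set" where
  "F_X = {p. \<forall>m. Poly_Mapping.lookup p m \<in> range Const}"

lemma dpol_deriv:
  assumes "derivation d"
  shows "derivation (dpol_deriv d)"
    and "dpol_deriv d (Const c) = Const (d c)"
    and "dpol_deriv d (Var (i, j, k)) = Var (i, j, Suc k)"
  using assms
  by (simp_all add: dpol_deriv_def derivation_ext_deriv ext_deriv_Const ext_deriv_Var)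

lemma R_deriv:
  assumes "derivation d"
  shows "derivation (R_deriv d)"
    and "R_deriv d (Const f) = Const (dpol_deriv d f)"
    and "R_deriv d (X_var i j) = (\<Sum>l\<in>UNIV. Const (Y_var i l) * X_var l j)"
  by (simp_all add: dpol_deriv(1)[OF assms] R_deriv_def X_var_def derivation_ext_deriv ext_deriv_Const ext_deriv_Var)

end

theory Submission
  imports Defs "HOL-Computational_Algebra.Polynomial_FPS"
begin

text \<open>Proof idea. Write $p = f(X)$ with $f \in F[X_{ij}]$. Then $D(p)$ is $f$ with its coefficients
  differentiated, plus the sum of the $Y_{il} E_{il} f$ with $E_{il} = \sum_j X_{lj}
  \partial/\partial X_{ij}$. Comparing coefficients in $D(p) = qp$ shows that $f$ is a common
  eigenvector of all $E_{il}$ and of the coefficientwise derivation. The commutation relations of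
  $\mathfrak{gl}_n$ force $E_{il} f = \delta_{il} a f$, and $a \in \mathbb{N}$ because $E_{ii}$
  multiplies a monomial by its degree in row $i$. With the adjugate, $f$ and $\det^a$ satisfy the
  same first order linear system, so along the line $I + t(X - I)$ both solve the same linear
  differential equation in $t$; hence $f = f(I) \det^a$. Applying the derivation to $f(I)$
  determines $q$.\<close>

section \<open>Derivations of commutative rings\<close>

lemma derivation_zero: "derivation (\<lambda>_. 0)"
  by (simp add: derivation_def)

lemma derivation_fps_deriv: "derivation (fps_deriv :: 'a::comm_ring_1 fps \<Rightarrow> 'a fps)"
  by (simp add: derivation_def algebra_simps)

context
  fixes D :: "'a::comm_ring_1 \<Rightarrow> 'a"
  assumes D: "derivation D"
begin

lemma derivation_add: "D (x + y) = D x + D y"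
  and derivation_mult: "D (x * y) = D x * y + x * D y"
  using D by (simp_all add: derivation_def)

lemma derivation_uminus: "D (- x) = - D x"
  using derivation_add[of x "- x"] derivation_0[OF D]
  by (metis add.right_inverse minus_unique)

lemma derivation_diff: "D (x - y) = D x - D y"
  using derivation_add[of x "- y"] derivation_uminus by simp

lemma derivation_of_nat: "D (of_nat n) = 0"
  by (induction n) (simp_all add: derivation_add derivation_0[OF D] derivation_1[OF D])

lemma derivation_of_int: "D (of_int k) = 0"
  by (cases k) (simp_all add: derivation_of_nat derivation_uminus derivation_diff derivation_1[OF D])

lemma derivation_sum: "D (sum f S) = (\<Sum>x\<in>S. D (f x))"
  by (induction S rule: infinite_finite_induct)
     (simp_all add: derivation_add derivation_0[OF D])

text \<open>Multiplying the power rule by \<open>x\<close> avoids the exponent \<open>n - 1\<close>,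
  so that \<open>n = 0\<close> is not a special case.\<close>

lemma derivation_power_mult: "x * D (x ^ n) = of_nat n * D x * x ^ n"
proof (induction n)
  case 0
  then show ?case by (simp add: derivation_1[OF D])
next
  case (Suc n)
  have "x * D (x ^ Suc n) = x * (D x * x ^ n) + x * (x * D (x ^ n))"
    by (simp add: derivation_mult algebra_simps)
  also have "\<dots> = of_nat (Suc n) * D x * x ^ Suc n"
    unfolding Suc.IH by (simp add: algebra_simps)
  finally show ?case .
qed

lemma derivation_prod:
  "finite S \<Longrightarrow> D (prod f S) = (\<Sum>i\<in>S. \<Prod>j\<in>S. if j = i then D (f j) else f j)"
proof (induction S rule: finite_induct)
  case empty
  then show ?case by (simp add: derivation_1[OF D])
next
  case (insert x S)
  have "(\<Prod>j\<in>S. if j = x then D (f j) else f j) = prod f S"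
    using insert.hyps by (intro prod.cong) auto
  moreover have "(\<Sum>i\<in>S. \<Prod>j\<in>insert x S. if j = i then D (f j) else f j) =
      (\<Sum>i\<in>S. f x * (\<Prod>j\<in>S. if j = i then D (f j) else f j))"
    using insert.hyps by (intro sum.cong refl) (auto simp: prod.insert)
  ultimately show ?case
    using insert by (simp add: derivation_mult sum_distrib_left)
qed

text \<open>The product rule is applied to every term of the Leibniz expansion; swapping the two
  sums collects the terms in which the factor from row \<open>i\<close> is differentiated.\<close>

lemma derivation_det:
  fixes A :: "'a ^ 'n::finite ^ 'n"
  shows "D (det A) = (\<Sum>i\<in>UNIV. det (\<chi> k l. if k = i then D (A $ k $ l) else A $ k $ l))"
proof -
  have "D (det A) = (\<Sum>\<pi>\<in>{\<pi>. \<pi> permutes (UNIV :: 'n set)}. \<Sum>i\<in>UNIV. of_int (sign \<pi>) *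
      (\<Prod>k\<in>UNIV. if k = i then D (A $ k $ \<pi> k) else A $ k $ \<pi> k))"
    by (simp add: det_def derivation_sum derivation_mult derivation_of_int derivation_prod
        sum_distrib_left)
  also have "\<dots> = (\<Sum>i\<in>UNIV. \<Sum>\<pi>\<in>{\<pi>. \<pi> permutes (UNIV :: 'n set)}. of_int (sign \<pi>) *
      (\<Prod>k\<in>UNIV. if k = i then D (A $ k $ \<pi> k) else A $ k $ \<pi> k))"
    by (rule sum.swap)
  finally show ?thesis by (simp add: det_def)
qed

end

lemma derivation_eqI:
  fixes D E :: "('v, 'a::comm_ring_1) mpol \<Rightarrow> ('v, 'a) mpol"
  assumes "derivation D" "derivation E"
    and "\<And>c. D (Const c) = E (Const c)" "\<And>v. D (Var v) = E (Var v)"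
  shows "D p = E p"
  by (induction p rule: mpol_induct)
     (simp_all add: assms(3,4) derivation_add[OF assms(1)] derivation_add[OF assms(2)]
       derivation_mult[OF assms(1)] derivation_mult[OF assms(2)])

lemma derivation_commutator:
  assumes "derivation D" "derivation E"
  shows "derivation (\<lambda>x. D (E x) - E (D x))"
  using assms by (simp add: derivation_def algebra_simps)

lemma derivation_minus_derivation:
  assumes "derivation D" "derivation E"
  shows "derivation (\<lambda>x. D x - E x)"
  using assms by (simp add: derivation_def algebra_simps)

section \<open>Ring homomorphisms and evaluation of polynomials\<close>

definition ring_homomorphism :: "('a::comm_ring_1 \<Rightarrow> 'b::comm_ring_1) \<Rightarrow> bool" where
  "ring_homomorphism h \<longleftrightarrow>
     h 1 = 1 \<and> (\<forall>x y. h (x + y) = h x + h y) \<and> (\<forall>x y. h (x * y) = h x * h y)"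

lemma ring_homomorphism_compose:
  "ring_homomorphism h \<Longrightarrow> ring_homomorphism k \<Longrightarrow> ring_homomorphism (\<lambda>x. h (k x))"
  by (simp add: ring_homomorphism_def)

lemma ring_homomorphism_id: "ring_homomorphism (\<lambda>x. x)"
  and ring_homomorphism_Const: "ring_homomorphism Const"
  and ring_homomorphism_pCons: "ring_homomorphism (\<lambda>c. [:c:])"
  and ring_homomorphism_fps_of_poly: "ring_homomorphism fps_of_poly"
  and ring_homomorphism_poly: "ring_homomorphism (\<lambda>f. poly f x)"
  by (simp_all add: ring_homomorphism_def Const_add Const_mult fps_of_poly_add fps_of_poly_mult)

context
  fixes h :: "'a::comm_ring_1 \<Rightarrow> 'b::comm_ring_1"
  assumes h: "ring_homomorphism h"
begin

lemma hom_1: "h 1 = 1"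
  and hom_add: "h (x + y) = h x + h y"
  and hom_mult: "h (x * y) = h x * h y"
  using h by (simp_all add: ring_homomorphism_def)

lemma hom_0: "h 0 = 0"
  using hom_add[of 0 0] by simp

lemma hom_uminus: "h (- x) = - h x"
  using hom_add[of x "- x"] hom_0 by (metis add.right_inverse minus_unique)

lemma hom_diff: "h (x - y) = h x - h y"
  using hom_add[of x "- y"] hom_uminus by simp

lemma hom_of_nat: "h (of_nat n) = of_nat n"
  by (induction n) (simp_all add: hom_0 hom_1 hom_add)

lemma hom_of_int: "h (of_int k) = of_int k"
  by (cases k) (simp_all add: hom_of_nat hom_uminus hom_diff hom_1)

lemma hom_sum: "h (sum f S) = (\<Sum>x\<in>S. h (f x))"
  by (induction S rule: infinite_finite_induct) (simp_all add: hom_0 hom_add)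

lemma hom_prod: "h (prod f S) = (\<Prod>x\<in>S. h (f x))"
  by (induction S rule: infinite_finite_induct) (simp_all add: hom_1 hom_mult)

lemma hom_power: "h (x ^ n) = h x ^ n"
  by (induction n) (simp_all add: hom_1 hom_mult)

lemma hom_det: "h (det A) = det (\<chi> i j. h (A $ i $ j))"
  by (simp add: det_def hom_sum hom_mult hom_prod hom_of_int)

end

text \<open>The product runs over all variables, not over the keys of \<open>m\<close>, so exponents
  add under multiplication without any tracking of supports. The map \<open>\<phi>\<close> on
  coefficients allows evaluation in a larger ring, such as polynomials in the parameter of a
  line.\<close>

definition eval_mpol ::
  "('a::comm_ring_1 \<Rightarrow> 'b::comm_ring_1) \<Rightarrow> ('v::finite \<Rightarrow> 'b) \<Rightarrow> ('v, 'a) mpol \<Rightarrow> 'b" where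
  "eval_mpol \<phi> g p =
     (\<Sum>m\<in>Poly_Mapping.keys p.
        \<phi> (Poly_Mapping.lookup p m) * (\<Prod>v\<in>UNIV. g v ^ Poly_Mapping.lookup m v))"

context
  fixes \<phi> :: "'a::comm_ring_1 \<Rightarrow> 'b::comm_ring_1" and g :: "'v::finite \<Rightarrow> 'b"
  assumes \<phi>: "ring_homomorphism \<phi>"
begin

lemma eval_mpol_superset:
  assumes "finite S" "Poly_Mapping.keys p \<subseteq> S"
  shows "eval_mpol \<phi> g p =
    (\<Sum>m\<in>S. \<phi> (Poly_Mapping.lookup p m) * (\<Prod>v\<in>UNIV. g v ^ Poly_Mapping.lookup m v))"
  unfolding eval_mpol_def
  by (rule sum.mono_neutral_left) (use assms in \<open>auto simp: in_keys_iff hom_0[OF \<phi>]\<close>)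

lemma eval_mpol_single:
  "eval_mpol \<phi> g (Poly_Mapping.single m c) =
     \<phi> c * (\<Prod>v\<in>UNIV. g v ^ Poly_Mapping.lookup m v)"
  by (subst eval_mpol_superset[of "{m}"]) auto

lemma eval_mpol_add: "eval_mpol \<phi> g (p + q) = eval_mpol \<phi> g p + eval_mpol \<phi> g q"
proof -
  let ?S = "Poly_Mapping.keys p \<union> Poly_Mapping.keys q"
  have "Poly_Mapping.keys (p + q) \<subseteq> ?S" by (rule Poly_Mapping.keys_add)
  then show ?thesis
    by (simp add: eval_mpol_superset[of ?S] lookup_add hom_add[OF \<phi>] sum.distrib algebra_simps)
qed

lemma eval_mpol_mult: "eval_mpol \<phi> g (p * q) = eval_mpol \<phi> g p * eval_mpol \<phi> g q"
proof -
  have zero: "eval_mpol \<phi> g 0 = 0" by (simp add: eval_mpol_def)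
  have single: "eval_mpol \<phi> g (Poly_Mapping.single m c * q) =
      eval_mpol \<phi> g (Poly_Mapping.single m c) * eval_mpol \<phi> g q" for m c q
    by (induction q rule: mpol_sum_induct)
       (simp_all add: zero mult_single eval_mpol_single eval_mpol_add hom_mult[OF \<phi>]
         lookup_add power_add prod.distrib ring_distribs mult_ac)
  show ?thesis
    by (induction p rule: mpol_sum_induct)
       (simp_all add: zero single eval_mpol_add ring_distribs)
qed

lemma eval_mpol_Const: "eval_mpol \<phi> g (Const c) = \<phi> c"
  by (simp add: Const_def eval_mpol_single)

lemma eval_mpol_Var: "eval_mpol \<phi> g (Var v) = g v"
proof -
  have "(\<Prod>w\<in>UNIV. g w ^ Poly_Mapping.lookup (Poly_Mapping.single v 1) w) =
      (\<Prod>w\<in>UNIV. if w = v then g w else 1)"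
    by (intro prod.cong) (auto simp: lookup_single)
  then show ?thesis by (simp add: Var_def eval_mpol_single hom_1[OF \<phi>])
qed

lemma ring_homomorphism_eval_mpol: "ring_homomorphism (eval_mpol \<phi> g)"
  using eval_mpol_Const[of 1]
  by (simp add: ring_homomorphism_def eval_mpol_add eval_mpol_mult hom_1[OF \<phi>])

end

lemma ring_homomorphism_mpol_eqI:
  fixes h k :: "('v, 'a::comm_ring_1) mpol \<Rightarrow> 'b::comm_ring_1"
  assumes "ring_homomorphism h" "ring_homomorphism k"
    and "\<And>c. h (Const c) = k (Const c)" "\<And>v. h (Var v) = k (Var v)"
  shows "h p = k p"
  by (induction p rule: mpol_induct)
     (simp_all add: assms(3,4) hom_add[OF assms(1)] hom_add[OF assms(2)]
       hom_mult[OF assms(1)] hom_mult[OF assms(2)])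

section \<open>Partial derivatives and the chain rule\<close>

definition partial_deriv :: "'v \<Rightarrow> ('v, 'a::comm_ring_1) mpol \<Rightarrow> ('v, 'a) mpol" where
  "partial_deriv v = ext_deriv (\<lambda>_. 0) (\<lambda>w. if w = v then 1 else 0)"

lemma derivation_partial_deriv: "derivation (partial_deriv v)"
  unfolding partial_deriv_def by (rule derivation_ext_deriv[OF derivation_zero])

lemma partial_deriv_Const: "partial_deriv v (Const c) = 0"
  and partial_deriv_Var: "partial_deriv v (Var w) = (if w = v then 1 else 0)"
  by (simp_all add: partial_deriv_def ext_deriv_Const ext_deriv_Var derivation_zero)

text \<open>With \<open>h\<close> the identity this expands a derivation that kills the coefficients
  in partial derivatives; with \<open>h\<close> a substitution and \<open>D\<close> the derivative
  of power series it differentiates a polynomial along a curve.\<close>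

lemma derivation_hom_chain_rule:
  fixes h :: "('v::finite, 'a::comm_ring_1) mpol \<Rightarrow> 'b::comm_ring_1"
  assumes h: "ring_homomorphism h" and D: "derivation D" and "\<And>c. D (h (Const c)) = 0"
  shows "D (h p) = (\<Sum>v\<in>UNIV. h (partial_deriv v p) * D (h (Var v)))"
proof (induction p rule: mpol_induct)
  case (Const c)
  then show ?case by (simp add: assms partial_deriv_Const hom_0[OF h])
next
  case (Var w)
  have "h (if w = v then 1 else 0) * D (h (Var v)) = (if w = v then D (h (Var v)) else 0)" for v
    by (simp add: hom_0[OF h] hom_1[OF h])
  then show ?case by (simp add: partial_deriv_Var)
next
  case (add p q)
  then show ?case
    by (simp add: hom_add[OF h] derivation_add[OF D] derivation_add[OF derivation_partial_deriv]
        ring_distribs sum.distrib)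
next
  case (mult p q)
  then show ?case
    by (simp add: hom_mult[OF h] hom_add[OF h] derivation_mult[OF D]
        derivation_mult[OF derivation_partial_deriv] sum.distrib sum_distrib_left
        sum_distrib_right algebra_simps)
qed

section \<open>Coefficients, formal linear differential equations and the adjugate\<close>

lemma lookup_Const_mult:
  "Poly_Mapping.lookup (Const c * p) m = c * Poly_Mapping.lookup p m"
  unfolding Const_def mult_map_scale_conv_mult[symmetric]
  by (simp add: Poly_Mapping.map.rep_eq when_def)

lemma lookup_of_nat_mult:
  fixes p :: "('v, 'a::comm_ring_1) mpol"
  shows "Poly_Mapping.lookup (of_nat n * p) m = of_nat n * Poly_Mapping.lookup p m"
  using lookup_Const_mult[of "of_nat n" p m] by (simp add: Const_def)

lemma Const_mult_eq_0_iff: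
  fixes c :: "'a::idom"
  shows "Const c * p = 0 \<longleftrightarrow> c = 0 \<or> p = 0"
  by (auto simp: poly_mapping_eq_iff fun_eq_iff lookup_Const_mult)

text \<open>The equation is a recursion: if the coefficients up to \<open>k\<close> vanish, its
  coefficient of degree \<open>k\<close> reduces to \<open>of_nat (Suc k)\<close> times the next
  one. Torsion-freeness is assumed of a commutative ring because the coefficients will be
  polynomials.\<close>

lemma fps_linear_ode_unique:
  fixes f g h :: "'a::comm_ring_1 fps"
  assumes torsion_free: "\<And>n (x :: 'a). of_nat (Suc n) * x = 0 \<Longrightarrow> x = 0"
    and ode: "g * fps_deriv f = f * h" and g: "fps_nth g 0 = 1" and f: "fps_nth f 0 = 0"
  shows "f = 0"
proof (rule fps_ext)
  fix n
  show "fps_nth f n = fps_nth 0 n"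
  proof (induction n rule: less_induct)
    case (less n)
    show ?case
    proof (cases n)
      case (Suc k)
      have "fps_nth (f * h) k = 0"
        using less Suc by (simp add: fps_mult_nth)
      moreover have "fps_nth (g * fps_deriv f) k =
          fps_nth g 0 * fps_nth (fps_deriv f) k"
      proof -
        \<comment> \<open>Coefficient \<open>k - i\<close> of the derivative involves coefficient
          \<open>k - i + 1\<close> of \<open>f\<close>, which for \<open>i > 0\<close> has index at
          most \<open>k\<close> and so vanishes by induction.\<close>
        have "fps_nth (g * fps_deriv f) k =
            (\<Sum>i=0..k. if i = 0 then fps_nth g 0 * fps_nth (fps_deriv f) k else 0)"
          unfolding fps_mult_nth
          by (intro sum.cong refl) (use less Suc in auto)
        then show ?thesis by simp
      qed
      ultimately have "of_nat (Suc k) * fps_nth f (Suc k) = 0"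
        using ode g by simp
      then show ?thesis using torsion_free Suc by simp
    qed (simp add: f)
  qed
qed

text \<open>Cramer's rule: \<open>M k l\<close> is the determinant of \<open>A\<close> with column
  \<open>k\<close> replaced by the unit vector at \<open>l\<close>. By linearity the sum replaces
  column \<open>k\<close> by column \<open>j\<close>, which repeats a column unless
  \<open>k = j\<close>. The columns are laid out as rows, since the determinant rules used are those
  for rows.\<close>

lemma left_adjugate_exists:
  fixes A :: "'a::comm_ring_1 ^ 'n::finite ^ 'n"
  obtains M where "\<And>k j. (\<Sum>l\<in>UNIV. M k l * A $ l $ j) = (if k = j then det A else 0)"
proof
  fix k j
  let ?col = "\<lambda>b. column b A"
  let ?M = "\<lambda>k l. det (\<chi> b. if b = k then axis l 1 else ?col b)"
  have col: "?col j = (\<Sum>l\<in>UNIV. A $ l $ j *s axis l 1)"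
    by (simp add: vec_eq_iff column_def axis_def if_distrib cong: if_cong)
  have "(\<Sum>l\<in>UNIV. ?M k l * A $ l $ j) =
      (\<Sum>l\<in>UNIV. det (\<chi> b. if b = k then A $ l $ j *s axis l 1 else ?col b))"
    by (subst det_row_mul) (simp add: mult.commute)
  also have "\<dots> = det (\<chi> b. if b = k then ?col j else ?col b)"
    unfolding col
    by (rule det_linear_row_sum[symmetric]) simp
  also have "\<dots> = (if k = j then det A else 0)"
  proof (cases "k = j")
    case True
    have "(\<chi> b. if b = k then ?col j else ?col b) = transpose A"
      using True by (simp add: vec_eq_iff column_def transpose_def)
    then show ?thesis using True by simp
  next
    case False
    then show ?thesis
      by (subst det_identical_rows[of k j]) (auto simp: row_def vec_eq_iff)
  qed
  finally show "(\<Sum>l\<in>UNIV. ?M k l * A $ l $ j) = (if k = j then det A else 0)" .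
qed

section \<open>Polarization operators on polynomials in the matrix entries\<close>

definition var_matrix :: "('n \<times> 'n, 'a::comm_ring_1) mpol ^ 'n::finite ^ 'n" where
  "var_matrix = (\<chi> i j. Var (i, j))"

lemma var_matrix_nth [simp]: "var_matrix $ i $ j = Var (i, j)"
  by (simp add: var_matrix_def)

text \<open>\<open>polarization i l\<close> is $E_{il} = \sum_j X_{lj} \partial/\partial X_{ij}$.\<close>

definition polarization ::
  "'n \<Rightarrow> 'n \<Rightarrow> ('n::finite \<times> 'n, 'a::comm_ring_1) mpol \<Rightarrow> ('n \<times> 'n, 'a) mpol" where
  "polarization i l = ext_deriv (\<lambda>_. 0) (\<lambda>(a, b). if a = i then Var (l, b) else 0)"

lemma derivation_polarization: "derivation (polarization i l)"
  unfolding polarization_def by (rule derivation_ext_deriv[OF derivation_zero])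

lemma polarization_Const: "polarization i l (Const c) = 0"
  and polarization_Var: "polarization i l (Var (a, b)) = (if a = i then Var (l, b) else 0)"
  by (simp_all add: polarization_def ext_deriv_Const ext_deriv_Var derivation_zero)

lemma polarization_0: "polarization i l 0 = 0"
  by (rule derivation_0[OF derivation_polarization])

lemma polarization_Const_mult: "polarization i l (Const c * p) = Const c * polarization i l p"
  by (simp add: derivation_mult[OF derivation_polarization] polarization_Const)

text \<open>These are the relations of the Lie algebra gl_n. Both sides are derivations that kill
  constants, so it is enough to compare them on the variables.\<close>

lemma polarization_commutator:
  fixes p :: "('n::finite \<times> 'n, 'a::comm_ring_1) mpol"
  shows "polarization i j (polarization k l p) - polarization k l (polarization i j p) =
     (if l = i then polarization k j p else 0) - (if j = k then polarization i l p else 0)"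
proof -
  \<comment> \<open>The Boolean switch makes each conditional term on the right a derivation, so
    that \<open>derivation_eqI\<close> applies to their difference.\<close>
  define E :: "bool \<Rightarrow> 'n \<Rightarrow> 'n \<Rightarrow> ('n \<times> 'n, 'a) mpol \<Rightarrow> ('n \<times> 'n, 'a) mpol"
    where "E b k j = (if b then polarization k j else (\<lambda>_. 0))" for b k j
  have E: "derivation (E b k j)" for b k j
    by (simp add: E_def derivation_polarization derivation_zero)
  have "polarization i j (polarization k l p) - polarization k l (polarization i j p) =
      E (l = i) k j p - E (j = k) i l p"
    by (rule derivation_eqI[OF derivation_commutator derivation_minus_derivation,
          OF derivation_polarization derivation_polarization E E])
       (auto simp: E_def polarization_Const polarization_Var polarization_0)
  then show ?thesis by (simp add: E_def split: if_splits)
qed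

lemma polarization_eq_partial_deriv:
  "polarization i l p = (\<Sum>j\<in>UNIV. Var (l, j) * partial_deriv (i, j) p)"
proof -
  have "polarization i l p =
      (\<Sum>v\<in>UNIV. partial_deriv v p * polarization i l (Var v))"
    by (rule derivation_hom_chain_rule[OF ring_homomorphism_id derivation_polarization])
       (rule polarization_Const)
  also have "\<dots> = (\<Sum>a\<in>UNIV. \<Sum>j\<in>UNIV. partial_deriv (a, j) p * polarization i l (Var (a, j)))"
    by (simp add: sum.cartesian_product)
  also have "\<dots> = (\<Sum>a\<in>UNIV. if a = i then \<Sum>j\<in>UNIV. Var (l, j) * partial_deriv (i, j) p else 0)"
    by (intro sum.cong) (auto simp: polarization_Var mult.commute)
  finally show ?thesis by simp
qed

text \<open>Only row \<open>i\<close> is differentiated, and it becomes row \<open>l\<close>; for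
  \<open>i \<noteq> l\<close> the result has two equal rows.\<close>

lemma polarization_det:
  "polarization i l (det var_matrix) = (if i = l then det var_matrix else 0)"
proof -
  have "polarization i l (det var_matrix) =
      (\<Sum>r\<in>UNIV. det (\<chi> a. if a = r then (if r = i then \<chi> b. Var (l, b) else 0)
         else row a var_matrix))"
    unfolding derivation_det[OF derivation_polarization]
    by (intro sum.cong refl arg_cong[of _ _ det])
       (auto simp: vec_eq_iff row_def polarization_Var)
  also have "\<dots> = (\<Sum>r\<in>UNIV. if r = i
      then det (\<chi> a. if a = i then \<chi> b. Var (l, b) else row a var_matrix) else 0)"
    by (intro sum.cong refl) (simp add: det_row_0)
  also have "\<dots> = det (\<chi> a. if a = i then \<chi> b. Var (l, b) else row a var_matrix)"
    by simp
  also have "\<dots> = (if i = l then det var_matrix else 0)"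
  proof (cases "i = l")
    case True
    then have "(\<chi> a. if a = i then \<chi> b. Var (l, b) else row a var_matrix) = var_matrix"
      by (simp add: vec_eq_iff row_def)
    then show ?thesis unfolding if_P[OF True] by (rule arg_cong)
  next
    case False
    then show ?thesis
      by (subst det_identical_rows[of i l]) (auto simp: row_def vec_eq_iff)
  qed
  finally show ?thesis .
qed

text \<open>This is the Euler operator of row \<open>i\<close>: monomials are eigenvectors, with
  their degree in the variables of row \<open>i\<close> as eigenvalue.\<close>

lemma lookup_polarization_diag:
  "Poly_Mapping.lookup (polarization i i p) m =
     of_nat (\<Sum>j\<in>UNIV. Poly_Mapping.lookup m (i, j)) * Poly_Mapping.lookup p m"
proof (induction p rule: mpol_sum_induct)
  case 1
  then show ?case by (simp add: polarization_0)
next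
  case (2 p q)
  then show ?case
    by (simp add: derivation_add[OF derivation_polarization] lookup_add distrib_left)
next
  case (3 n c)
  \<comment> \<open>Subtraction of exponents truncates, which does no harm: when \<open>v\<close>
    does not occur in \<open>n\<close>, the coefficient is zero.\<close>
  have *: "Poly_Mapping.single (n - Poly_Mapping.single v 1) (of_nat (Poly_Mapping.lookup n v) * c) *
      Var v = Poly_Mapping.single n (of_nat (Poly_Mapping.lookup n v) * c)" for v
  proof (cases "Poly_Mapping.lookup n v = 0")
    case False
    then have "n - Poly_Mapping.single v 1 + Poly_Mapping.single v 1 = n"
      by (intro poly_mapping_eqI) (auto simp: lookup_add lookup_minus lookup_single when_def)
    then show ?thesis by (simp add: Var_def mult_single)
  qed simp
  have "polarization i i (Poly_Mapping.single n c) =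
      (\<Sum>v\<in>UNIV. Poly_Mapping.single (n - Poly_Mapping.single v 1)
        (of_nat (Poly_Mapping.lookup n v) * c) * (case v of (a, b) \<Rightarrow> if a = i then Var (i, b) else 0))"
    unfolding polarization_def by (simp only: ext_deriv_single[OF derivation_zero finite subset_UNIV] single_zero add_0_left)
  also have "\<dots> = (\<Sum>v\<in>UNIV. if fst v = i
      then Poly_Mapping.single n (of_nat (Poly_Mapping.lookup n v) * c) else 0)"
    using * by (intro sum.cong refl) (auto simp del: One_nat_def)
  also have "\<dots> = (\<Sum>a\<in>UNIV. \<Sum>b\<in>UNIV. if a = i
      then Poly_Mapping.single n (of_nat (Poly_Mapping.lookup n (a, b)) * c) else 0)"
    unfolding sum.cartesian_product UNIV_Times_UNIV by (rule sum.cong) auto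
  also have "\<dots> = (\<Sum>a\<in>UNIV. if a = i
      then \<Sum>b\<in>UNIV. Poly_Mapping.single n (of_nat (Poly_Mapping.lookup n (i, b)) * c) else 0)"
    by (intro sum.cong) auto
  also have "\<dots> = (\<Sum>b\<in>UNIV. Poly_Mapping.single n (of_nat (Poly_Mapping.lookup n (i, b)) * c))"
    by simp
  finally show ?case
    by (auto simp: lookup_sum lookup_single when_def sum_distrib_right)
qed

section \<open>Common eigenvectors of the polarizations are multiples of powers of the
  determinant\<close>

text \<open>Commutators vanish on a common eigenvector because scalars commute. The bracket of E_il
  with E_ii is E_il for \<open>i \<noteq> l\<close>, so off-diagonal eigenvalues are zero; the
  bracket of E_il with E_li is E_ll - E_ii, so the diagonal ones agree.\<close>

lemma polarization_eigenvalues: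
  fixes p :: "('n::finite \<times> 'n, 'a::field_char_0) mpol"
  assumes "p \<noteq> 0" and eigen: "\<And>i l. polarization i l p = Const (c i l) * p"
  obtains a :: nat where "\<And>i l. c i l = (if i = l then of_nat a else 0)"
proof -
  obtain m where m: "Poly_Mapping.lookup p m \<noteq> 0"
    using \<open>p \<noteq> 0\<close> by (metis poly_mapping_eqI lookup_zero)
  have comm: "polarization i j (polarization k l p) - polarization k l (polarization i j p) = 0"
    for i j k l
    by (simp add: eigen polarization_Const_mult mult.left_commute)
  have off: "c i l = 0" if "i \<noteq> l" for i l
  proof -
    have "polarization i l p = 0"
      using comm[of i l i i] that unfolding polarization_commutator by simp
    then show ?thesis using \<open>p \<noteq> 0\<close> by (simp add: eigen Const_mult_eq_0_iff)
  qed
  have diag: "c i i = c l l" for i l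
  proof (cases "i = l")
    case False
    have "polarization l l p = polarization i i p"
      using comm[of i l l i] unfolding polarization_commutator by simp
    then have "Poly_Mapping.lookup (Const (c i i) * p) m = Poly_Mapping.lookup (Const (c l l) * p) m"
      by (simp add: eigen)
    then show ?thesis using m by (simp add: lookup_Const_mult)
  qed simp
  obtain a :: nat where a: "c undefined undefined = of_nat a"
  proof
    \<comment> \<open>The index \<open>undefined\<close> stands for some row; by \<open>diag\<close>
      all rows give the same eigenvalue, which is the degree of \<open>m\<close> in that
      row.\<close>
    show "c undefined undefined = of_nat (\<Sum>j\<in>UNIV. Poly_Mapping.lookup m (undefined, j))"
      using lookup_polarization_diag[of undefined p m] m
      by (simp add: eigen lookup_Const_mult)
  qed
  show ?thesis
    by (rule that[of a]) (use off diag a in metis)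
qed

text \<open>For fixed \<open>i\<close> the eigenvalue equations are a linear system for the partial
  derivatives in row \<open>i\<close>, with the generic matrix as its matrix. Multiplication by the
  adjugate \<open>M\<close> solves it up to the factor \<open>det var_matrix\<close>.\<close>

lemma polarization_eigenvector_partial_deriv:
  fixes p :: "('n::finite \<times> 'n, 'a::comm_ring_1) mpol"
  assumes eigen: "\<And>i l. polarization i l p = (if i = l then of_nat a * p else 0)"
    and M: "\<And>k j. (\<Sum>l\<in>UNIV. M k l * var_matrix $ l $ j) = (if k = j then det var_matrix else 0)"
  shows "det var_matrix * partial_deriv (i, k) p = M k i * (of_nat a * p)"
proof -
  have "(\<Sum>l\<in>UNIV. M k l * polarization i l p) =
      (\<Sum>l\<in>UNIV. \<Sum>j\<in>UNIV. M k l * Var (l, j) * partial_deriv (i, j) p)"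
    by (simp add: polarization_eq_partial_deriv sum_distrib_left mult.assoc)
  also have "\<dots> = (\<Sum>j\<in>UNIV. (\<Sum>l\<in>UNIV. M k l * var_matrix $ l $ j) * partial_deriv (i, j) p)"
    by (subst sum.swap) (simp add: sum_distrib_right)
  also have "\<dots> = (\<Sum>j\<in>UNIV. if k = j then det var_matrix * partial_deriv (i, k) p else 0)"
    unfolding M by (intro sum.cong) auto
  also have "\<dots> = det var_matrix * partial_deriv (i, k) p"
    by simp
  finally show ?thesis
    by (simp add: eigen if_distrib cong: if_cong)
qed

lemma polarization_eigenvector_eq_det_power:
  fixes p :: "('n::finite \<times> 'n, 'a::field_char_0) mpol"
  assumes eigen: "\<And>i l. polarization i l p = (if i = l then of_nat a * p else 0)"
  shows "p = Const (eval_mpol (\<lambda>x. x) (\<lambda>(i, j). if i = j then 1 else 0) p) *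
               det var_matrix ^ a"
proof -
  let ?\<delta> = "\<lambda>(i, j). if i = j then 1 else 0"
  \<comment> \<open>the line from the identity matrix at $t = 0$ to the generic matrix at $t = 1$\<close>
  define g :: "'n \<times> 'n \<Rightarrow> ('n \<times> 'n, 'a) mpol poly"
    where "g v = [:?\<delta> v, Var v - ?\<delta> v:]" for v
  let ?C = "\<lambda>c::'a. [:Const c:] :: ('n \<times> 'n, 'a) mpol poly"
  have C: "ring_homomorphism ?C"
    by (rule ring_homomorphism_compose[OF ring_homomorphism_pCons ring_homomorphism_Const])
  define E where "E = eval_mpol ?C g"
  have E: "ring_homomorphism E"
    unfolding E_def by (rule ring_homomorphism_eval_mpol[OF C])
  have E_Const: "E (Const c) = ?C c" and E_Var: "E (Var v) = g v" for c v
    by (simp_all add: E_def eval_mpol_Const[OF C] eval_mpol_Var[OF C])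
  \<comment> \<open>Polynomials in t can be evaluated at 0 and 1; power series provide uniqueness
    for the differential equation. Hence both versions of the substitution.\<close>
  define h where "h x = fps_of_poly (E x)" for x
  have h: "ring_homomorphism h"
    unfolding h_def by (rule ring_homomorphism_compose[OF ring_homomorphism_fps_of_poly E])
  have E1: "poly (E x) 1 = x" for x
    by (rule ring_homomorphism_mpol_eqI[OF ring_homomorphism_compose[OF ring_homomorphism_poly E]
          ring_homomorphism_id])
       (auto simp: E_Const E_Var g_def)
  have E0: "poly (E x) 0 = Const (eval_mpol (\<lambda>x. x) ?\<delta> x)" for x
    by (rule ring_homomorphism_mpol_eqI[OF ring_homomorphism_compose[OF ring_homomorphism_poly E]
          ring_homomorphism_compose[OF ring_homomorphism_Const
            ring_homomorphism_eval_mpol[OF ring_homomorphism_id]]])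
       (auto simp: E_Const E_Var g_def eval_mpol_Const eval_mpol_Var ring_homomorphism_id)
  let ?det = "det var_matrix :: ('n \<times> 'n, 'a) mpol"
  have det0: "eval_mpol (\<lambda>x. x) ?\<delta> ?det = 1"
  proof -
    have "eval_mpol (\<lambda>x. x) ?\<delta> ?det = det (mat 1 :: 'a ^ 'n ^ 'n)"
      unfolding hom_det[OF ring_homomorphism_eval_mpol[OF ring_homomorphism_id]]
      by (intro arg_cong[of _ _ det])
         (simp add: vec_eq_iff mat_def eval_mpol_Var ring_homomorphism_id)
    then show ?thesis by simp
  qed
  define \<Delta> where "\<Delta> = h ?det"
  have \<Delta>0: "fps_nth \<Delta> 0 = 1"
    using E0[of ?det] by (simp add: \<Delta>_def h_def det0 poly_0_coeff_0)
  obtain M where M: "\<And>k j. (\<Sum>l\<in>UNIV. M k l * (var_matrix :: ('n \<times> 'n, 'a) mpol ^ 'n ^ 'n) $ l $ j) =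
      (if k = j then ?det else 0)"
    by (rule left_adjugate_exists[of "var_matrix :: ('n \<times> 'n, 'a) mpol ^ 'n ^ 'n"]) (rule that)
  \<comment> \<open>By Jacobi's formula this is the derivative of the determinant along the line:
    the trace of the adjugate times the velocity.\<close>
  define \<mu> where "\<mu> = (\<Sum>v\<in>UNIV. h (M (snd v) (fst v)) * fps_deriv (h (Var v)))"
  \<comment> \<open>The exponent \<open>b\<close> is kept general to cover both \<open>p\<close>,
    with \<open>b = a\<close>, and the determinant, with \<open>b = 1\<close>.\<close>
  have ode: "\<Delta> * fps_deriv (h x) = of_nat b * h x * \<mu>"
    if "\<And>i l. polarization i l x = (if i = l then of_nat b * x else 0)" for x b
  proof -
    have "\<Delta> * fps_deriv (h x) =
        (\<Sum>v\<in>UNIV. h (?det * partial_deriv v x) * fps_deriv (h (Var v)))"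
      by (subst derivation_hom_chain_rule[OF h derivation_fps_deriv])
         (auto simp: h_def E_Const fps_of_poly_const \<Delta>_def sum_distrib_left mult.assoc
           hom_mult[OF E] fps_of_poly_mult)
    also have "\<dots> = of_nat b * h x * \<mu>"
      unfolding \<mu>_def sum_distrib_left
    proof (intro sum.cong refl)
      fix v :: "'n \<times> 'n"
      have "?det * partial_deriv v x = M (snd v) (fst v) * (of_nat b * x)"
        using polarization_eigenvector_partial_deriv[OF that M, of "fst v" "snd v"] by simp
      then show "h (?det * partial_deriv v x) * fps_deriv (h (Var v)) =
          of_nat b * h x * (h (M (snd v) (fst v)) * fps_deriv (h (Var v)))"
        by (simp add: hom_mult[OF h] hom_of_nat[OF h] mult_ac)
    qed
    finally show ?thesis .
  qed
  have ode_\<Delta>: "\<Delta> * fps_deriv \<Delta> = \<Delta> * \<mu>"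
    using ode[of ?det 1] by (simp add: polarization_det \<Delta>_def)
  define U where "U = h p"
  define W where "W = U - fps_const (fps_nth U 0) * \<Delta> ^ a"
  \<comment> \<open>multiplied by one more factor \<open>\<Delta>\<close>, because \<open>ode_\<Delta>\<close> gives $\Delta' = \mu$ only up to the factor \<open>\<Delta>\<close>\<close>
  have ode_W: "(\<Delta> * \<Delta>) * fps_deriv W = W * (of_nat a * \<Delta> * \<mu>)"
  proof -
    have "(\<Delta> * \<Delta>) * fps_deriv U = U * (of_nat a * \<Delta> * \<mu>)"
      using ode[OF eigen] by (simp add: U_def mult_ac)
    moreover have "(\<Delta> * \<Delta>) * fps_deriv (\<Delta> ^ a) = \<Delta> ^ a * (of_nat a * \<Delta> * \<mu>)"
    proof -
      have "(\<Delta> * \<Delta>) * fps_deriv (\<Delta> ^ a) = \<Delta> * (of_nat a * fps_deriv \<Delta> * \<Delta> ^ a)"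
        by (simp only: mult.assoc derivation_power_mult[OF derivation_fps_deriv])
      also have "\<dots> = of_nat a * \<Delta> ^ a * (\<Delta> * fps_deriv \<Delta>)"
        by (simp add: mult_ac)
      finally show ?thesis by (simp add: ode_\<Delta> mult_ac)
    qed
    ultimately show ?thesis
      by (simp only: W_def fps_deriv_sub fps_deriv_mult_const_left right_diff_distrib
          left_diff_distrib mult.left_commute[of "\<Delta> * \<Delta>"] mult.assoc[of "fps_const _"])
  qed
  have torsion_free: "x = 0" if "of_nat (Suc n) * x = 0" for n and x :: "('n \<times> 'n, 'a) mpol"
  proof (rule poly_mapping_eqI)
    fix m
    have "of_nat (Suc n) * Poly_Mapping.lookup x m = 0"
      using that lookup_of_nat_mult[of "Suc n" x m] by simp
    then show "Poly_Mapping.lookup x m = Poly_Mapping.lookup 0 m"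
      by (simp del: of_nat_Suc)
  qed
  \<comment> \<open>The initial value \<open>\<Delta>0\<close> serves twice: it makes the constant
    term of \<open>W\<close> vanish, and it gives the leading coefficient
    \<open>\<Delta> * \<Delta>\<close> constant term 1.\<close>
  have "W = 0"
    by (rule fps_linear_ode_unique[OF torsion_free ode_W])
       (simp_all add: W_def \<Delta>0 fps_nth_power_0)
  then have "U = fps_const (fps_nth U 0) * \<Delta> ^ a"
    unfolding W_def by (rule eq_iff_diff_eq_0[THEN iffD2])
  then have "fps_of_poly (E p) = fps_of_poly ([:coeff (E p) 0:] * E ?det ^ a)"
    by (simp only: U_def \<Delta>_def h_def fps_of_poly_mult fps_of_poly_power fps_of_poly_const
        fps_of_poly_nth)
  then have "E p = [:coeff (E p) 0:] * E ?det ^ a"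
    by (simp only: fps_of_poly_eq_iff)
  \<comment> \<open>Setting t = 1 returns from the line to the generic matrix, while the coefficient
    at degree 0 is the value at the identity.\<close>
  then have "poly (E p) 1 = poly ([:coeff (E p) 0:] * E ?det ^ a) 1"
    by (rule arg_cong)
  also have "\<dots> = coeff (E p) 0 * poly (E ?det) 1 ^ a"
    by (simp only: poly_mult poly_power poly_pCons poly_0 mult_zero_right add_0_right)
  finally have "poly (E p) 1 = coeff (E p) 0 * poly (E ?det) 1 ^ a" .
  then show ?thesis
    unfolding E1 poly_0_coeff_0[symmetric] E0 .
qed

section \<open>The embedding of F[X] in R and the derivation of R on its image\<close>

lemma ring_homomorphism_map_Const:
  "ring_homomorphism (Poly_Mapping.map Const :: ('w, 'a::comm_ring_1) mpol \<Rightarrow> ('w, ('v, 'a) mpol) mpol)"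
proof -
  let ?h = "Poly_Mapping.map Const :: ('w, 'a) mpol \<Rightarrow> ('w, ('v, 'a) mpol) mpol"
  have add: "?h (x + y) = ?h x + ?h y" for x y
    by (rule poly_mapping_eqI)
       (auto simp: Poly_Mapping.map.rep_eq lookup_add Const_add when_def simp flip: Const_add)
  have 0: "?h 0 = 0"
    by (rule poly_mapping_eqI) (simp add: Poly_Mapping.map.rep_eq)
  have single: "?h (Poly_Mapping.single m c) = Poly_Mapping.single m (Const c)" for m c
    by (rule map_single) simp
  have single_mult: "?h (Poly_Mapping.single m c * y) = ?h (Poly_Mapping.single m c) * ?h y" for m c y
    by (induction y rule: mpol_sum_induct)
       (simp_all add: 0 add single mult_single Const_mult distrib_left)
  have "?h (x * y) = ?h x * ?h y" for x y
    by (induction x rule: mpol_sum_induct) (simp_all add: 0 add single_mult distrib_right)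
  moreover have "?h 1 = 1"
    using single[of 0 1] by simp
  ultimately show ?thesis by (simp add: ring_homomorphism_def add)
qed

lemma map_Const_Const: "Poly_Mapping.map Const (Const c) = Const (Const c)"
  and map_Const_Var: "Poly_Mapping.map Const (Var v) = Var v"
  by (simp_all add: Const_def[of c] Var_def Const_def[of "Const c"] map_single)
     (simp add: Const_def)

lemma lookup_map_Const:
  "Poly_Mapping.lookup (Poly_Mapping.map Const p) m = Const (Poly_Mapping.lookup p m)"
  by (auto simp: Poly_Mapping.map.rep_eq when_def)

text \<open>Both sides satisfy the product rule along the embedding, so the generators decide. The
  formula separates the part free of Y from the parts linear in each Y_il.\<close>

lemma R_deriv_map_Const:
  fixes p :: "('n::finite \<times> 'n, 'a::comm_ring_1) mpol"
  assumes d: "derivation d"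
  shows "R_deriv d (Poly_Mapping.map Const p) =
    Poly_Mapping.map Const (ext_deriv d (\<lambda>_. 0) p) +
    (\<Sum>i\<in>UNIV. \<Sum>l\<in>UNIV. Const (Y_var i l) * Poly_Mapping.map Const (polarization i l p))"
proof (induction p rule: mpol_induct)
  case (Const c)
  then show ?case
    by (simp add: map_Const_Const R_deriv(2)[OF d] dpol_deriv(2)[OF d] ext_deriv_Const[OF d]
        polarization_Const hom_0[OF ring_homomorphism_map_Const])
next
  case (Var v)
  obtain a b where v: "v = (a, b)" by force
  have "(\<Sum>i\<in>UNIV. \<Sum>l\<in>UNIV. Const (Y_var i l) * Poly_Mapping.map Const (polarization i l (Var v :: ('n \<times> 'n, 'a) mpol))) =
      (\<Sum>i\<in>UNIV. if i = a then \<Sum>l\<in>UNIV. Const (Y_var a l) * X_var l b else 0)"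
    by (intro sum.cong)
       (auto simp: v polarization_Var map_Const_Var X_var_def hom_0[OF ring_homomorphism_map_Const])
  then show ?case
    using R_deriv(3)[OF d, of a b]
    unfolding v map_Const_Var ext_deriv_Var[OF d] X_var_def hom_0[OF ring_homomorphism_map_Const]
    by simp
next
  case (add p q)
  then show ?case
    by (simp add: hom_add[OF ring_homomorphism_map_Const] derivation_add[OF R_deriv(1)[OF d]]
        derivation_add[OF derivation_ext_deriv[OF d]] derivation_add[OF derivation_polarization]
        distrib_left sum.distrib)
next
  case (mult p q)
  then show ?case
    by (simp add: hom_mult[OF ring_homomorphism_map_Const] hom_add[OF ring_homomorphism_map_Const]
        derivation_mult[OF R_deriv(1)[OF d]] derivation_mult[OF derivation_ext_deriv[OF d]]
        derivation_mult[OF derivation_polarization] ring_distribs sum.distrib sum_distrib_left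
        sum_distrib_right mult_ac add_ac)
qed

text \<open>At a point with constant coordinates, differentiating the coefficients is the same as
  differentiating the value. It is applied at the identity matrix.\<close>

lemma eval_mpol_ext_deriv:
  assumes d: "derivation d" and "\<And>v. d (g v) = 0"
  shows "eval_mpol (\<lambda>x. x) g (ext_deriv d (\<lambda>_. 0) p) = d (eval_mpol (\<lambda>x. x) g p)"
proof -
  note ev = ring_homomorphism_eval_mpol[OF ring_homomorphism_id]
  show ?thesis
    by (induction p rule: mpol_induct)
       (simp_all add: ext_deriv_Const[OF d] ext_deriv_Var[OF d] assms(2) hom_0[OF ev]
         hom_add[OF ev] hom_mult[OF ev] derivation_add[OF d] derivation_mult[OF d]
         derivation_add[OF derivation_ext_deriv[OF d]] derivation_mult[OF derivation_ext_deriv[OF d]]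
         eval_mpol_Const[OF ring_homomorphism_id] eval_mpol_Var[OF ring_homomorphism_id])
qed

lemma F_X_eq_range: "(F_X :: ('n, 'a::comm_ring_1) dpol_X set) = range (Poly_Mapping.map Const)"
proof -
  have "p \<in> range (Poly_Mapping.map Const)" if "p \<in> F_X" for p :: "('n, 'a) dpol_X"
  proof
    \<comment> \<open>Taking the constant term is a left inverse of \<open>Const\<close>.\<close>
    let ?p = "Poly_Mapping.map (\<lambda>c. Poly_Mapping.lookup c 0) p"
    show "p = Poly_Mapping.map Const ?p"
    proof (rule poly_mapping_eqI)
      fix m
      have "Poly_Mapping.lookup p m \<in> range Const"
        using that by (simp add: F_X_def)
      then obtain c where "Poly_Mapping.lookup p m = Const c" by blast
      then show "Poly_Mapping.lookup p m = Poly_Mapping.lookup (Poly_Mapping.map Const ?p) m"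
        by (simp add: lookup_map_Const Poly_Mapping.map.rep_eq when_def)
           (auto simp: Const_def)
    qed
  qed (rule UNIV_I)
  then show ?thesis by (auto simp: F_X_def lookup_map_Const)
qed

text \<open>The elements 1 and Y_il are linearly independent over F, so one identity between such
  forms in F{Y} yields an identity in F for each coefficient.\<close>

lemma lookup_linear_form:
  shows "Poly_Mapping.lookup (Const c + (\<Sum>i\<in>UNIV. \<Sum>l\<in>UNIV. Y_var i l * Const (b i l))) 0 = c"
    and "Poly_Mapping.lookup (Const c + (\<Sum>i\<in>UNIV. \<Sum>l\<in>UNIV. Y_var i l * Const (b i l)))
      (Poly_Mapping.single (i, l, 0) 1) = b (i :: 'n::finite) l"
proof -
  have Y: "Y_var i l * Const (b i l) = Poly_Mapping.single (Poly_Mapping.single (i, l, 0) 1) (b i l)" for i l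
    by (simp add: Y_var_def Var_def Const_def mult_single)
  have ne: "Poly_Mapping.single v (1::nat) \<noteq> 0" for v :: "'n \<times> 'n \<times> nat"
    by (metis lookup_single_eq lookup_zero zero_neq_one)
  have inj: "Poly_Mapping.single v (1::nat) = Poly_Mapping.single w 1 \<longleftrightarrow> v = w"
    for v w :: "'n \<times> 'n \<times> nat"
    by (metis lookup_single_eq lookup_single_not_eq zero_neq_one)
  show "Poly_Mapping.lookup (Const c + (\<Sum>i\<in>UNIV. \<Sum>l\<in>UNIV. Y_var i l * Const (b i l))) 0 = c"
    unfolding Y using ne by (simp add: lookup_add lookup_sum lookup_single Const_def)
  have "(\<Sum>i'\<in>UNIV. \<Sum>l'\<in>UNIV. b i' l' when (i', l', 0::nat) = (i, l, 0)) =
      (\<Sum>i'\<in>UNIV. if i' = i then (\<Sum>l'\<in>UNIV. if l' = l then b i l else 0) else 0)"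
    by (intro sum.cong refl) (auto simp: when_def intro!: sum.cong)
  then show "Poly_Mapping.lookup (Const c + (\<Sum>i\<in>UNIV. \<Sum>l\<in>UNIV. Y_var i l * Const (b i l)))
      (Poly_Mapping.single (i, l, 0) 1) = b i l"
    unfolding Y using ne[of "(i, l, 0)"]
    by (simp add: lookup_add lookup_sum lookup_single Const_def inj del: One_nat_def)
qed

section \<open>Comparison of coefficients, first in X and then in Y\<close>

theorem theorem1p4p15:
  fixes d :: "'a::field_char_0 \<Rightarrow> 'a"
    and p :: "('n::finite, 'a) dpol_X"
    and q :: "('n, 'a) dpol"
  assumes "derivation d"
    and "alg_closed_subfield (constants d)"
    and "p \<in> F_X"
    and "p \<noteq> 0"
    and "R_deriv d p = Const q * p"
  shows "\<exists>(a::nat) (l::'a).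
           p = Const (Const l) * det X_matrix ^ a \<and>
           q = Const (d l / l) + of_nat a * (\<Sum>i\<in>UNIV. Y_var i i)"
proof -
  note d = assms(1)
  let ?\<iota> = "Poly_Mapping.map Const :: ('n \<times> 'n, 'a) mpol \<Rightarrow> ('n, 'a) dpol_X"
  note \<iota> = ring_homomorphism_map_Const
  obtain f where f: "p = ?\<iota> f"
    using assms(3) by (auto simp: F_X_eq_range)
  have "f \<noteq> 0" using assms(4) by (auto simp: f hom_0[OF \<iota>])
  then obtain m0 where m0: "Poly_Mapping.lookup f m0 \<noteq> 0"
    by (metis poly_mapping_eqI lookup_zero)
  let ?fd = "ext_deriv d (\<lambda>_. 0) f"
  have coeff: "q * Const (Poly_Mapping.lookup f m) = Const (Poly_Mapping.lookup ?fd m) +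
      (\<Sum>i\<in>UNIV. \<Sum>l\<in>UNIV. Y_var i l * Const (Poly_Mapping.lookup (polarization i l f) m))" for m
    using arg_cong[OF assms(5), of "\<lambda>x. Poly_Mapping.lookup x m"]
    by (simp add: f R_deriv_map_Const[OF d] lookup_add lookup_sum lookup_Const_mult lookup_map_Const)
  \<comment> \<open>Dividing by the nonzero coefficient of \<open>f\<close> at \<open>m0\<close>
    shows that \<open>q\<close> is an affine linear form in the Y_il over F; \<open>c0\<close> and
    \<open>c\<close> are its coefficients.\<close>
  define c0 where "c0 = Poly_Mapping.lookup ?fd m0 / Poly_Mapping.lookup f m0"
  define c where
    "c i l = Poly_Mapping.lookup (polarization i l f) m0 / Poly_Mapping.lookup f m0" for i l
  have q: "q = Const c0 + (\<Sum>i\<in>UNIV. \<Sum>l\<in>UNIV. Y_var i l * Const (c i l))"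
  proof -
    have "q = q * Const (Poly_Mapping.lookup f m0) * Const (1 / Poly_Mapping.lookup f m0)"
      using m0 by (simp add: mult.assoc flip: Const_mult)
    also have "\<dots> = Const c0 + (\<Sum>i\<in>UNIV. \<Sum>l\<in>UNIV. Y_var i l * Const (c i l))"
      unfolding coeff
      by (simp add: c0_def c_def distrib_right sum_distrib_right mult.assoc flip: Const_mult)
    finally show ?thesis .
  qed
  \<comment> \<open>With \<open>q\<close> in this form, both sides are affine linear forms in the
    Y_il for every monomial \<open>m\<close>, and their coefficients can be compared.\<close>
  have coeff': "Const (c0 * Poly_Mapping.lookup f m) +
      (\<Sum>i\<in>UNIV. \<Sum>l\<in>UNIV. Y_var i l * Const (c i l * Poly_Mapping.lookup f m)) =
      Const (Poly_Mapping.lookup ?fd m) +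
      (\<Sum>i\<in>UNIV. \<Sum>l\<in>UNIV. Y_var i l * Const (Poly_Mapping.lookup (polarization i l f) m))" for m
    using coeff[of m]
    by (simp add: q distrib_right sum_distrib_right mult.assoc flip: Const_mult)
  have fd: "?fd = Const c0 * f"
  proof (rule poly_mapping_eqI)
    fix m
    show "Poly_Mapping.lookup ?fd m = Poly_Mapping.lookup (Const c0 * f) m"
      using arg_cong[OF coeff', of "\<lambda>x. Poly_Mapping.lookup x 0" m]
      by (simp only: lookup_linear_form lookup_Const_mult)
  qed
  have eigen: "polarization i l f = Const (c i l) * f" for i l
  proof (rule poly_mapping_eqI)
    fix m
    show "Poly_Mapping.lookup (polarization i l f) m = Poly_Mapping.lookup (Const (c i l) * f) m"
      using arg_cong[OF coeff', of "\<lambda>x. Poly_Mapping.lookup x (Poly_Mapping.single (i, l, 0) 1)" m]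
      by (simp only: lookup_linear_form lookup_Const_mult)
  qed
  obtain a :: nat where a: "\<And>i l. c i l = (if i = l then of_nat a else 0)"
    using polarization_eigenvalues[OF \<open>f \<noteq> 0\<close> eigen] by blast
  define L where "L = eval_mpol (\<lambda>x. x) (\<lambda>(i, j). if i = j then 1 else 0) f"
  have of_nat_Const: "Const (of_nat k) = of_nat k" for k
    by (rule hom_of_nat[OF ring_homomorphism_Const])
  have "f = Const L * det var_matrix ^ a"
    unfolding L_def
    by (rule polarization_eigenvector_eq_det_power) (simp add: eigen a of_nat_Const)
  \<comment> \<open>The embedding \<open>?\<iota>\<close> takes the entries of
    \<open>var_matrix\<close> to those of \<open>X_matrix\<close>.\<close>
  then have p: "p = Const (Const L) * det X_matrix ^ a" and "L \<noteq> 0"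
    using \<open>f \<noteq> 0\<close>
    by (auto simp: f hom_mult[OF \<iota>] hom_power[OF \<iota>] map_Const_Const hom_det[OF \<iota>] map_Const_Var
        X_matrix_def X_var_def)
  have "d L = c0 * L"
  proof -
    \<comment> \<open>The entries 0 and 1 of the identity matrix are constants of \<open>d\<close>,
      so the eigenvalue equation \<open>fd\<close> can be evaluated there.\<close>
    have "d L = eval_mpol (\<lambda>x. x) (\<lambda>(i, j). if i = j then 1 else 0) ?fd"
      unfolding L_def
      by (rule eval_mpol_ext_deriv[OF d, symmetric]) (auto simp: derivation_0[OF d] derivation_1[OF d])
    then show ?thesis
      by (simp add: fd L_def eval_mpol_mult eval_mpol_Const ring_homomorphism_id)
  qed
  then have "c0 = d L / L" using \<open>L \<noteq> 0\<close> by simp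
  moreover have "(\<Sum>i\<in>UNIV. \<Sum>l\<in>UNIV. Y_var i l * Const (c i l)) =
      (of_nat a * (\<Sum>i\<in>UNIV. Y_var i i) :: ('n, 'a) dpol)"
  proof -
    have "Y_var i l * Const (c i l) = (if l = i then of_nat a * Y_var i i else 0)" for i l
      by (simp add: a of_nat_Const mult.commute)
    then show ?thesis by (simp add: sum_distrib_left)
  qed
  ultimately show ?thesis using p q by auto
qed

end
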